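(* Let $n\in\mathbb{N}$ and let $f\in H_n([0,\infty))$, where $$H_n([0,\infty)) := \big\{f:[0,\infty)\to\mathbb{C} \,\big|\, f^{(j)}\in AC_{loc}([0,\infty)),\ j=0,\dots,n-1;\ f^{(n)}\in L^2((0,\infty));\ f^{(j)}(0)=0,\ j=0,\dots,n-1\big\}.$$ Then: (i) $f^{(n-j)}/x^{j}\in L^2((0,\infty))$ for $j=0,1,\dots,n$; (ii) $\lim_{x\uparrow\infty} |f^{(j)}(x)|^2/x^{2n-2j-1}=0$ for $j=0,1,\dots,n-1$; (iii) $\lim_{x\downarrow 0} |f^{(j)}(x)|^2/x^{2n-2j-1}=0$ for $j=0,1,\dots,n-1$. In addition, for every $n\in\mathbb{N}$, if $f\in \widehat H_n((0,\infty))$ then $f'\in \widehat H_{n-1}((0,\infty))$, where for $m\in\mathbb{N}_0$ $$\widehat H_m((0,\infty)) := \big\{f:(0,\infty)\to\mathbb{C} \,\big|\, f^{(j)}\in AC_{loc}((0,\infty)),\ j=0,\dots,m-1;\ f^{(m)},\ f/x^{m}\in L^2((0,\infty))\big\}$$ (so that $\widehat H_0((0,\infty))=L^2((0,\infty))$).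
   Context: $AC_{loc}([0,\infty))$ denotes functions absolutely continuous on $[0,c]$ for every $c>0$; $AC_{loc}((0,\infty))$ denotes functions absolutely continuous on every compact subinterval of $(0,\infty)$. *)

theory Defs
  imports "HOL-Analysis.Analysis"
begin

definition AC_on :: "real set \<Rightarrow> (real \<Rightarrow> 'a::real_normed_vector) \<Rightarrow> bool" where
  "AC_on I f \<longleftrightarrow>
     (\<forall>\<epsilon>>0. \<exists>\<delta>>0. \<forall>(N::nat) (a::nat \<Rightarrow> real) (b::nat \<Rightarrow> real).
        (\<forall>k<N. a k \<le> b k \<and> {a k..b k} \<subseteq> I) \<and>
        (\<forall>i<N. \<forall>j<N. i \<noteq> j \<longrightarrow> {a i<..<b i} \<inter> {a j<..<b j} = {}) \<and>
        (\<Sum>k<N. b k - a k) < \<delta>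
        \<longrightarrow> (\<Sum>k<N. norm (f (b k) - f (a k))) < \<epsilon>)"

definition AC_loc_closed :: "(real \<Rightarrow> 'a::real_normed_vector) \<Rightarrow> bool" where
  "AC_loc_closed f \<longleftrightarrow> (\<forall>c>0. AC_on {0..c} f)"

definition AC_loc_open :: "(real \<Rightarrow> 'a::real_normed_vector) \<Rightarrow> bool" where
  "AC_loc_open f \<longleftrightarrow> (\<forall>a b. 0 < a \<and> a \<le> b \<longrightarrow> AC_on {a..b} f)"

definition L2_on :: "real set \<Rightarrow> (real \<Rightarrow> complex) \<Rightarrow> bool" where
  "L2_on S h \<longleftrightarrow> h \<in> borel_measurable (lebesgue_on S) \<and>
                  integrable (lebesgue_on S) (\<lambda>x. (norm (h x))\<^sup>2)"

text \<open>g 0, g 1, ..., g n represent f, f', ..., f^(n): for j < n, g (j+1) is the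
  (a.e.) derivative of g j on (0,\<infinity>).\<close>
definition deriv_chain :: "nat \<Rightarrow> (nat \<Rightarrow> real \<Rightarrow> complex) \<Rightarrow> bool" where
  "deriv_chain n g \<longleftrightarrow>
     (\<forall>j<n. AE x in lebesgue. x > 0 \<longrightarrow> (g j has_vector_derivative g (Suc j) x) (at x))"

definition H_chain :: "nat \<Rightarrow> (real \<Rightarrow> complex) \<Rightarrow> (nat \<Rightarrow> real \<Rightarrow> complex) \<Rightarrow> bool" where
  "H_chain n f g \<longleftrightarrow>
     (\<forall>x\<ge>0. g 0 x = f x) \<and>
     (\<forall>j<n. AC_loc_closed (g j)) \<and>
     deriv_chain n g \<and>
     L2_on {0<..} (g n) \<and>
     (\<forall>j<n. g j 0 = 0)"

definition in_H :: "nat \<Rightarrow> (real \<Rightarrow> complex) \<Rightarrow> bool" where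
  "in_H n f \<longleftrightarrow> (\<exists>g. H_chain n f g)"

definition Hhat_chain :: "nat \<Rightarrow> (real \<Rightarrow> complex) \<Rightarrow> (nat \<Rightarrow> real \<Rightarrow> complex) \<Rightarrow> bool" where
  "Hhat_chain m f g \<longleftrightarrow>
     (\<forall>x>0. g 0 x = f x) \<and>
     (\<forall>j<m. AC_loc_open (g j)) \<and>
     deriv_chain m g \<and>
     L2_on {0<..} (g m) \<and>
     L2_on {0<..} (\<lambda>x. f x / complex_of_real (x ^ m))"

definition in_Hhat :: "nat \<Rightarrow> (real \<Rightarrow> complex) \<Rightarrow> bool" where
  "in_Hhat m f \<longleftrightarrow> (\<exists>g. Hhat_chain m f g)"

end

theory Submission
  imports Defs
begin

text \<open>Write \<open>h = norm (g n)\<close> and \<open>H x = integral {0..x} h\<close>. For an \<open>H\<close>-chain all Taylor coefficients at \<open>0\<close>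
  vanish, so \<open>norm (g (n - j) x) \<le> x ^ (j - 1) * H x\<close>; hence (i) follows from Hardy's inequality
  \<open>H x / x \<in> L\<^sup>2\<close>, and (ii), (iii) from \<open>(H x)\<^sup>2 / x \<longlongrightarrow> 0\<close> at \<open>\<infinity>\<close> and at \<open>0\<close>.

  For an \<open>Hhat\<close>-chain one expands at \<open>x\<close> instead: comparing \<open>f ((1 + t) * x)\<close> with its Taylor polynomial
  at \<open>x\<close> and dividing by \<open>x ^ n\<close>, both the left-hand side (by scaling) and the remainder (by Hardy's
  inequality) are square integrable for every \<open>t > 0\<close>. So the polynomial in \<open>t\<close> with coefficients
  \<open>x ^ i * g i x / (fact i * x ^ n)\<close> is square integrable for every \<open>t > 0\<close>, and then so is each
  coefficient; the one with \<open>i = 1\<close> is the claim.\<close>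

subsection \<open>Absolutely continuous functions\<close>

text \<open>Numbering a finite set by an initial segment of the naturals turns the sequences in
  \<open>AC_on_def\<close> into families over any finite index set. This lets the tagged intervals
  of a division serve as indices themselves.\<close>

lemma AC_on_finite_family:
  fixes f :: "real \<Rightarrow> 'a::real_normed_vector"
  assumes "AC_on I f" "e > 0"
  shows "\<exists>d>0. \<forall>(S :: 'c set) u v. finite S \<and> (\<forall>i\<in>S. u i \<le> v i \<and> {u i..v i} \<subseteq> I) \<and>
       (\<forall>i\<in>S. \<forall>j\<in>S. i \<noteq> j \<longrightarrow> {u i<..<v i} \<inter> {u j<..<v j} = {}) \<and>
       (\<Sum>i\<in>S. v i - u i) < d \<longrightarrow> (\<Sum>i\<in>S. norm (f (v i) - f (u i))) < e"
proof -
  obtain d where "d > 0" and d: "\<forall>(N::nat) a b.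
        (\<forall>k<N. a k \<le> b k \<and> {a k..b k} \<subseteq> I) \<and>
        (\<forall>i<N. \<forall>j<N. i \<noteq> j \<longrightarrow> {a i<..<b i} \<inter> {a j<..<b j} = {}) \<and>
        (\<Sum>k<N. b k - a k) < d
        \<longrightarrow> (\<Sum>k<N. norm (f (b k) - f (a k))) < e"
    using assms(1)[unfolded AC_on_def, THEN spec, THEN mp, OF assms(2)] by (elim exE conjE)
  show ?thesis
  proof (intro exI[of _ d] conjI \<open>d > 0\<close> allI impI, elim conjE)
    fix S :: "'c set" and u v
    assume fin: "finite S" and sub: "\<forall>i\<in>S. u i \<le> v i \<and> {u i..v i} \<subseteq> I"
      and dis: "\<forall>i\<in>S. \<forall>j\<in>S. i \<noteq> j \<longrightarrow> {u i<..<v i} \<inter> {u j<..<v j} = {}"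
      and len: "(\<Sum>i\<in>S. v i - u i) < d"
    obtain h where h: "bij_betw h {..<card S} S"
      using ex_bij_betw_nat_finite[OF fin] by (auto simp: atLeast0LessThan)
    have re: "(\<Sum>i\<in>S. w i) = (\<Sum>k<card S. w (h k))" for w :: "'c \<Rightarrow> real"
      using sum.reindex_bij_betw[OF h, of w] by simp
    have inS: "h k \<in> S" if "k < card S" for k
      using h that by (auto simp: bij_betw_def)
    have inj: "h i \<noteq> h j" if "i < card S" "j < card S" "i \<noteq> j" for i j
      using h that by (auto simp: bij_betw_def inj_on_def)
    have "(\<forall>k<card S. u (h k) \<le> v (h k) \<and> {u (h k)..v (h k)} \<subseteq> I)"
      using sub inS by simp
    moreover have "\<forall>i<card S. \<forall>j<card S. i \<noteq> j \<longrightarrow> {u (h i)<..<v (h i)} \<inter> {u (h j)<..<v (h j)} = {}"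
      using dis inS inj by simp
    ultimately show "(\<Sum>i\<in>S. norm (f (v i) - f (u i))) < e"
      using d[THEN spec, THEN spec, THEN spec, of "card S" "\<lambda>k. u (h k)" "\<lambda>k. v (h k)"] len
      unfolding re by blast
  qed
qed

text \<open>The gauge integral permits a separate choice of scale at each tag. Tags off
  \<open>N\<close> are handled by differentiability, and tags in \<open>N\<close> by absolute
  continuity on a small open cover of \<open>N\<close>. Integrability of \<open>f'\<close> is thus a
  conclusion and not an assumption.\<close>

lemma AC_on_has_integral:
  fixes f :: "real \<Rightarrow> 'a::banach"
  assumes "a \<le> b" and AC: "AC_on {a..b} f" and N: "negligible N"
    and der: "\<And>x. x \<in> {a..b} - N \<Longrightarrow> (f has_vector_derivative f' x) (at x within {a..b})"
  shows "(f' has_integral (f b - f a)) {a..b}"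
proof -
  \<comment> \<open>With the value 0 on \<open>N\<close>, a term tagged in \<open>N\<close>
    contributes only an increment of \<open>f\<close>.\<close>
  define F where "F = (\<lambda>x. if x \<in> N then 0 else f' x)"
  have "(F has_integral (f b - f a)) {a..b}"
    unfolding has_integral_real
  proof (intro allI impI)
    fix e :: real assume "e > 0"
    \<comment> \<open>The summand 1 keeps the denominator positive when
      \<open>a = b\<close>.\<close>
    define e' where "e' = e / (2 * (b - a + 1))"
    have e': "e' > 0" "e' * (b - a) \<le> e / 2"
      using \<open>e > 0\<close> \<open>a \<le> b\<close> by (auto simp: e'_def field_simps)
    obtain \<delta> where "\<delta> > 0" and \<delta>: "\<forall>(S :: (real \<times> real set) set) u v.
       finite S \<and> (\<forall>i\<in>S. u i \<le> v i \<and> {u i..v i} \<subseteq> {a..b}) \<and>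
       (\<forall>i\<in>S. \<forall>j\<in>S. i \<noteq> j \<longrightarrow> {u i<..<v i} \<inter> {u j<..<v j} = {}) \<and>
       (\<Sum>i\<in>S. v i - u i) < \<delta> \<longrightarrow> (\<Sum>i\<in>S. norm (f (v i) - f (u i))) < e / 2"
      using AC_on_finite_family[OF AC half_gt_zero[OF \<open>e > 0\<close>]] by (elim exE conjE)
    \<comment> \<open>Intervals tagged in \<open>N\<close> will be confined to \<open>U\<close>, so
      their total length stays below the \<open>\<delta>\<close> supplied by absolute
      continuity.\<close>
    obtain U where "open U" "N \<subseteq> U" and UN: "U - N \<in> lmeasurable" "emeasure lebesgue (U - N) < ennreal \<delta>"
      using sets_lebesgue_outer_open[of N \<delta>] N \<open>\<delta> > 0\<close>
      by (metis negligible_imp_sets)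
    have Ueq: "U = (U - N) \<union> N" using \<open>N \<subseteq> U\<close> by auto
    have Ulm: "U \<in> lmeasurable"
      using N UN(1) by (metis Ueq fmeasurable.Un negligible_imp_measurable)
    have "measure lebesgue U \<le> measure lebesgue (U - N) + measure lebesgue N"
      by (subst Ueq, rule measure_Un_le)
        (use UN N in \<open>auto simp: negligible_imp_sets fmeasurableD\<close>)
    also have "\<dots> < \<delta>"
      using UN \<open>\<delta> > 0\<close> N by (simp add: negligible_imp_measure0 emeasure_eq_measure2 ennreal_less_iff)
    finally have Umeas: "measure lebesgue U < \<delta>" .
    have "\<forall>x. \<exists>d>0. x \<in> {a..b} - N \<longrightarrow>
         (\<forall>y\<in>{a..b}. norm (y - x) < d \<longrightarrow> norm (f y - f x - (y - x) *\<^sub>R f' x) \<le> e' * norm (y - x))"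
      using der[unfolded has_vector_derivative_def has_derivative_within_alt] e'(1) by blast
    then obtain d where d0: "\<And>x. 0 < d x"
      and d: "\<And>x y. \<lbrakk>x \<in> {a..b} - N; y \<in> {a..b}; norm (y - x) < d x\<rbrakk>
                  \<Longrightarrow> norm (f y - f x - (y - x) *\<^sub>R f' x) \<le> e' * norm (y - x)"
      by metis
    define \<gamma> where "\<gamma> = (\<lambda>x. if x \<in> N then U else ball x (d x))"
    have gauge: "gauge \<gamma>"
      unfolding gauge_def \<gamma>_def using \<open>open U\<close> \<open>N \<subseteq> U\<close> d0 by auto
    have bound: "norm (sum (\<lambda>(x,k). measure lborel k *\<^sub>R F x) D - (f b - f a)) < e"
      if tag: "D tagged_division_of {a..b}" and fine: "\<gamma> fine D" for D
    proof -
      have fin: "finite D" by (rule tagged_division_ofD(1)[OF tag])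
      define D1 where "D1 = {p \<in> D. fst p \<notin> N}"
      define D2 where "D2 = {p \<in> D. fst p \<in> N}"
      \<comment> \<open>The endpoints are recovered as \<open>Inf\<close> and \<open>Sup\<close> of
        the interval, so every sum can run over the division itself.\<close>
      have interval: "snd p = {Inf (snd p)..Sup (snd p)} \<and> Inf (snd p) \<le> Sup (snd p) \<and>
          snd p \<subseteq> {a..b} \<and> fst p \<in> snd p \<and> snd p \<subseteq> \<gamma> (fst p) \<and>
          Inf (snd p) \<in> snd p \<and> Sup (snd p) \<in> snd p" if pD: "p \<in> D" for p
      proof -
        obtain x K where p: "p = (x, K)" by (cases p)
        obtain u v where K: "K = {u..v}"
          using tagged_division_ofD(4)[OF tag pD[unfolded p]] by auto
        moreover have "x \<in> K" "K \<subseteq> {a..b}"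
          using tagged_division_ofD(2,3)[OF tag pD[unfolded p]] by auto
        moreover have "K \<subseteq> \<gamma> x" using fineD[OF fine pD[unfolded p]] .
        ultimately show ?thesis using p by auto
      qed
      have cont: "measure lborel (snd p) = Sup (snd p) - Inf (snd p)" if pD: "p \<in> D" for p
        using interval[OF pD] by (metis measure_lborel_Icc)
      have *: "f b - f a = (\<Sum>p\<in>D. f (Sup (snd p)) - f (Inf (snd p)))"
        using additive_tagged_division_1[OF \<open>a \<le> b\<close> tag, of f] by (simp add: case_prod_unfold)
      have tot: "b - a = (\<Sum>p\<in>D. measure lborel (snd p))"
        using additive_tagged_division_1[OF \<open>a \<le> b\<close> tag, of "\<lambda>x. x"] cont
        by (simp add: case_prod_unfold)
      let ?q = "\<lambda>p. measure lborel (snd p) *\<^sub>R F (fst p) - (f (Sup (snd p)) - f (Inf (snd p)))"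
      have "sum (\<lambda>(x,k). measure lborel k *\<^sub>R F x) D - (f b - f a) = sum ?q D"
        unfolding * by (simp add: case_prod_unfold sum_subtractf)
      also have "\<dots> = sum ?q D1 + sum ?q D2"
        unfolding D1_def D2_def using fin by (subst sum.union_disjoint[symmetric]) (auto intro!: sum.cong)
      finally have eq: "sum (\<lambda>(x,k). measure lborel k *\<^sub>R F x) D - (f b - f a) = sum ?q D1 + sum ?q D2" .
      \<comment> \<open>tags where \<open>f\<close> is differentiable: the straddle estimate\<close>
      have "norm (sum ?q D1) \<le> (\<Sum>p\<in>D1. e' * measure lborel (snd p))"
      proof (rule sum_norm_le)
        fix p assume "p \<in> D1"
        then have p: "p \<in> D" "fst p \<notin> N" by (auto simp: D1_def)
        define x u v where "x = fst p" and "u = Inf (snd p)" and "v = Sup (snd p)"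
        have i: "u \<le> x" "x \<le> v" "u \<in> {a..b}" "v \<in> {a..b}" "x \<in> {a..b} - N"
           "u \<in> ball x (d x)" "v \<in> ball x (d x)"
          using interval[OF p(1)] p(2) unfolding \<gamma>_def x_def u_def v_def by auto
        have "norm ((v - u) *\<^sub>R f' x - (f v - f u))
            = norm ((f u - f x - (u - x) *\<^sub>R f' x) - (f v - f x - (v - x) *\<^sub>R f' x))"
          by (auto simp: algebra_simps)
        also have "\<dots> \<le> e' * norm (u - x) + e' * norm (v - x)"
          by (rule order_trans[OF norm_triangle_ineq4 add_mono[OF d d]])
            (use i in \<open>auto simp: dist_real_def\<close>)
        also have "\<dots> = e' * (v - u)" using i by (simp add: algebra_simps)
        finally show "norm (?q p) \<le> e' * measure lborel (snd p)"
          using p cont[OF p(1)] by (simp add: F_def x_def u_def v_def)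
      qed
      also have "\<dots> \<le> e' * (b - a)"
        unfolding tot sum_distrib_left
        using fin e' by (intro sum_mono2) (auto simp: D1_def)
      also have "\<dots> \<le> e / 2" by (rule e')
      finally have 1: "norm (sum ?q D1) \<le> e / 2" .
      \<comment> \<open>tags in \<open>N\<close>: \<open>F\<close> vanishes there and the intervals lie in \<open>U\<close>, so absolute continuity applies\<close>
      have D2D: "p \<in> D" if "p \<in> D2" for p using that by (simp add: D2_def)
      have disj: "interior (snd p) \<inter> interior (snd q) = {}" if "p \<in> D2" "q \<in> D2" "p \<noteq> q" for p q
        using tagged_division_ofD(5)[OF tag] D2D that by (metis prod.collapse)
      have icc: "\<exists>u v. snd p = {u..v}" if "p \<in> D2" for p
        using interval[OF D2D[OF that]] by blast
      have lm: "snd p \<in> lmeasurable" if "p \<in> D2" for p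
        using icc[OF that] by (metis box_real(2) lmeasurable_cbox)
      \<comment> \<open>The intervals overlap only in negligible sets, so their total length is the
        measure of their union, which lies inside \<open>U\<close>.\<close>
      have "(\<Sum>p\<in>D2. Sup (snd p) - Inf (snd p)) = (\<Sum>p\<in>D2. measure lebesgue (snd p))"
      proof (intro sum.cong refl)
        fix p assume p: "p \<in> D2"
        obtain u v where "snd p = {u..v}" using icc[OF p] by blast
        then show "Sup (snd p) - Inf (snd p) = measure lebesgue (snd p)"
          unfolding cont[OF D2D[OF p], symmetric] by simp
      qed
      also have "\<dots> = measure lebesgue (\<Union>(snd ` D2))"
      proof (rule measure_negligible_finite_Union_image[symmetric])
        show "finite D2" using fin by (simp add: D2_def)
        show "snd p \<in> lmeasurable" if "p \<in> D2" for p using lm[OF that] .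
        show "pairwise (\<lambda>p q. negligible (snd p \<inter> snd q)) D2"
        proof (rule pairwiseI)
          fix p q assume pq: "p \<in> D2" "q \<in> D2" "p \<noteq> q"
          have "convex (snd p)" "convex (snd q)"
            using icc pq by (metis convex_real_interval(5))+
          then show "negligible (snd p \<inter> snd q)"
            using disj[OF pq] by (simp add: negligible_convex_interior convex_Int)
        qed
      qed
      also have "\<dots> \<le> measure lebesgue U"
      proof (rule measure_mono_fmeasurable[OF _ _ Ulm])
        show "\<Union>(snd ` D2) \<subseteq> U"
        proof (rule UN_least)
          fix p assume "p \<in> D2"
          then have "p \<in> D" "\<gamma> (fst p) = U" by (auto simp: D2_def \<gamma>_def)
          then show "snd p \<subseteq> U" using interval by metis
        qed
        show "\<Union>(snd ` D2) \<in> sets lebesgue"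
          using fin lm by (intro sets.finite_UN fmeasurableD) (auto simp: D2_def)
      qed
      also have "\<dots> < \<delta>" by (rule Umeas)
      finally have "(\<Sum>p\<in>D2. Sup (snd p) - Inf (snd p)) < \<delta>" .
      moreover have "finite D2" using fin by (simp add: D2_def)
      moreover have "\<forall>p\<in>D2. Inf (snd p) \<le> Sup (snd p) \<and> {Inf (snd p)..Sup (snd p)} \<subseteq> {a..b}"
        using interval D2D by metis
      moreover have "\<forall>p\<in>D2. \<forall>q\<in>D2. p \<noteq> q \<longrightarrow> {Inf (snd p)<..<Sup (snd p)} \<inter> {Inf (snd q)<..<Sup (snd q)} = {}"
        using disj interval D2D by (metis interior_atLeastAtMost_real)
      ultimately have "(\<Sum>p\<in>D2. norm (f (Sup (snd p)) - f (Inf (snd p)))) < e / 2"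
        using \<delta>[THEN spec, THEN spec, THEN spec, of D2 "\<lambda>p. Inf (snd p)" "\<lambda>p. Sup (snd p)"]
        by (simp only: simp_thms)
      moreover have "norm (sum ?q D2) \<le> (\<Sum>p\<in>D2. norm (f (Sup (snd p)) - f (Inf (snd p))))"
        by (rule sum_norm_le) (simp add: D2_def F_def norm_minus_commute)
      ultimately show ?thesis
        unfolding eq using 1 norm_triangle_ineq[of "sum ?q D1" "sum ?q D2"] by linarith
    qed
    show "\<exists>\<gamma>. gauge \<gamma> \<and> (\<forall>D. D tagged_division_of {a..b} \<and> \<gamma> fine D \<longrightarrow>
        norm (sum (\<lambda>(x,k). measure lborel k *\<^sub>R F x) D - (f b - f a)) < e)"
      using gauge by (intro exI[of _ \<gamma>] conjI allI impI) (simp_all only: bound)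
  qed
  then show ?thesis
    by (rule has_integral_spike[OF N, rotated]) (simp add: F_def)
qed

lemma AC_on_subset: "AC_on I f \<Longrightarrow> J \<subseteq> I \<Longrightarrow> AC_on J f"
  unfolding AC_on_def by (elim all_forward imp_forward ex_forward conj_forward) (auto dest: subset_trans)

text \<open>Two-sided derivatives are available only in the interior, so both endpoints join the
  exceptional null set.\<close>

corollary AC_on_has_integral_AE:
  fixes f :: "real \<Rightarrow> 'a::banach"
  assumes "a \<le> b" "AC_on {a..b} f"
    and der: "AE x in lebesgue. x \<in> {a<..<b} \<longrightarrow> (f has_vector_derivative f' x) (at x)"
  shows "(f' has_integral (f b - f a)) {a..b}"
proof -
  obtain N where N: "N \<in> null_sets lebesgue"
    "\<And>x. x \<notin> N \<Longrightarrow> x \<in> {a<..<b} \<longrightarrow> (f has_vector_derivative f' x) (at x)"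
    using AE_E3[OF der] by (metis DiffI UNIV_I space_completion space_lborel space_borel)
  show ?thesis
  proof (rule AC_on_has_integral[OF assms(1,2)])
    show "negligible (insert a (insert b N))"
      using N(1) by (simp add: negligible_iff_null_sets[symmetric])
    show "(f has_vector_derivative f' x) (at x within {a..b})" if "x \<in> {a..b} - insert a (insert b N)" for x
      using N(2)[of x] that by (auto intro: has_vector_derivative_at_within)
  qed
qed

text \<open>Replacing both functions by 0 on the exceptional set changes neither integral and makes
  the bound hold everywhere. The almost-everywhere form is needed because the Borel majorant used
  later dominates only almost everywhere.\<close>

lemma has_integral_norm_bound_AE:
  fixes f :: "real \<Rightarrow> 'a::banach"
  assumes f: "(f has_integral i) S" and h: "h integrable_on S"
    and le: "AE x in lebesgue. x \<in> S \<longrightarrow> norm (f x) \<le> h x"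
  shows "norm i \<le> integral S h"
proof -
  obtain N where N: "N \<in> null_sets lebesgue" "\<And>x. x \<notin> N \<Longrightarrow> x \<in> S \<longrightarrow> norm (f x) \<le> h x"
    using AE_E3[OF le] by (metis DiffI UNIV_I space_completion space_lborel space_borel)
  then have neg: "negligible N" by (simp add: negligible_iff_null_sets)
  define f0 h0 where "f0 = (\<lambda>x. if x \<in> N then 0 else f x)" and "h0 = (\<lambda>x. if x \<in> N then 0 else h x)"
  have f0: "(f0 has_integral i) S"
    by (rule has_integral_spike[OF neg _ f]) (simp add: f0_def)
  have h0: "(h0 has_integral integral S h) S"
    by (rule has_integral_spike[OF neg _ integrable_integral[OF h]]) (simp add: h0_def)
  have "norm (integral S f0) \<le> integral S h0"
    by (rule integral_norm_bound_integral) (use f0 h0 N in \<open>auto simp: f0_def h0_def\<close>)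
  then show ?thesis using f0 h0 by (simp add: integral_unique)
qed

section \<open>Taylor's formula for chains of absolutely continuous functions\<close>

text \<open>Integrating the Taylor polynomial of a derivative yields that of the function without
  its constant term; this is the induction step of the remainder estimate below.\<close>

lemma has_integral_taylor_sum:
  fixes c :: "nat \<Rightarrow> 'a::banach"
  assumes "a \<le> y"
  shows "((\<lambda>s. \<Sum>i<n. ((s - a) ^ i / fact i) *\<^sub>R c i) has_integral
           (\<Sum>i<n. ((y - a) ^ Suc i / fact (Suc i)) *\<^sub>R c i)) {a..y}"
proof (intro has_integral_sum has_integral_scaleR_left)
  fix i :: nat
  have "((\<lambda>s. (s - a) ^ i / fact i) has_integral
      ((y - a) ^ Suc i / fact (Suc i) - (a - a) ^ Suc i / fact (Suc i))) {a..y}"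
  proof (rule fundamental_theorem_of_calculus[OF assms])
    fix x
    have "((\<lambda>s. s - a) has_real_derivative 1) (at x within {a..y})"
      by (auto intro!: derivative_eq_intros)
    from DERIV_cdivide[OF DERIV_power_Suc[OF this], of i "fact (Suc i)"]
    have "((\<lambda>s. (s - a) ^ Suc i / fact (Suc i)) has_real_derivative
        (1 + real i) * (1 * (x - a) ^ i) / fact (Suc i)) (at x within {a..y})" .
    also have "(1 + real i) * (1 * (x - a) ^ i) / fact (Suc i) = (x - a) ^ i / fact i"
      unfolding fact_Suc of_nat_Suc mult_1_left of_nat_mult by (rule mult_divide_mult_cancel_left) simp
    finally show "((\<lambda>s. (s - a) ^ Suc i / fact (Suc i)) has_vector_derivative (x - a) ^ i / fact i)
        (at x within {a..y})"
      by (simp only: has_real_derivative_iff_has_vector_derivative)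
  qed
  then show "((\<lambda>s. (s - a) ^ i / fact i) has_integral (y - a) ^ Suc i / fact (Suc i)) {a..y}"
    by simp
qed simp

text \<open>Induction on \<open>n\<close>: the remainder of \<open>g 0\<close> is the integral of
  the remainder of \<open>g 1\<close>, which is at most its uniform bound times the length
  \<open>y - a\<close>. Factorials in the bound are given up, since constants are harmless for
  square integrability and for limits equal to 0.\<close>

lemma AC_taylor_bound:
  fixes g :: "nat \<Rightarrow> real \<Rightarrow> 'a::banach"
  assumes "\<And>j. j \<le> n \<Longrightarrow> AC_on {a..b} (g j)"
    and "\<And>j. j \<le> n \<Longrightarrow> AE x in lebesgue. x \<in> {a<..<b} \<longrightarrow> (g j has_vector_derivative g (Suc j) x) (at x)"
    and "AE x in lebesgue. x \<in> {a..b} \<longrightarrow> norm (g (Suc n) x) \<le> h x"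
    and h: "h integrable_on {a..b}" "\<And>x. 0 \<le> h x"
    and y: "y \<in> {a..b}"
  shows "norm (g 0 y - (\<Sum>i\<le>n. ((y - a) ^ i / fact i) *\<^sub>R g i a)) \<le> (y - a) ^ n * integral {a..y} h"
  using assms(1-3) y
proof (induction n arbitrary: g y)
  case 0
  have sub: "{a..y} \<subseteq> {a..b}" using 0(4) by auto
  have "(g 1 has_integral (g 0 y - g 0 a)) {a..y}"
    by (rule AC_on_has_integral_AE)
      (use 0(4) AC_on_subset[OF 0(1) sub] in \<open>auto intro: AE_mp[OF 0(2)[OF order_refl]]\<close>)
  then have "norm (g 0 y - g 0 a) \<le> integral {a..y} h"
    by (rule has_integral_norm_bound_AE)
      (use 0(4) integrable_subinterval_real[OF h(1) sub] in \<open>auto intro: AE_mp[OF 0(3)]\<close>)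
  then show ?case by simp
next
  case (Suc n)
  let ?P = "\<lambda>s. \<Sum>i<Suc n. ((s - a) ^ i / fact i) *\<^sub>R g (Suc i) a"
  have sub: "{a..y} \<subseteq> {a..b}" using Suc.prems(4) by auto
  have ay: "a \<le> y" using Suc.prems(4) by simp
  have hy: "h integrable_on {a..y}" by (rule integrable_subinterval_real[OF h(1) sub])
  \<comment> \<open>The induction hypothesis is applied to the shifted chain. Both factors of its
    bound increase with \<open>s\<close>, so their values at \<open>y\<close> serve for all
    \<open>s\<close>.\<close>
  have bound: "norm (g 1 s - ?P s) \<le> (y - a) ^ n * integral {a..y} h" if "s \<in> {a..y}" for s
  proof -
    have "norm (g 1 s - ?P s) \<le> (s - a) ^ n * integral {a..s} h"
      using Suc.IH[of "\<lambda>j. g (Suc j)" s] Suc.prems that by (simp add: lessThan_Suc_atMost)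
    also have "\<dots> \<le> (y - a) ^ n * integral {a..y} h"
    proof (rule mult_mono)
      show "integral {a..s} h \<le> integral {a..y} h"
        by (rule integral_subset_le)
          (use that hy h(2) in \<open>auto intro: integrable_subinterval_real[OF hy]\<close>)
      show "0 \<le> integral {a..s} h" by (rule integral_nonneg)
          (use that hy h(2) in \<open>auto intro: integrable_subinterval_real[OF hy]\<close>)
    qed (use that in \<open>auto intro: power_mono\<close>)
    finally show ?thesis .
  qed
  have int: "((\<lambda>s. g 1 s - ?P s) has_integral
      (g 0 y - g 0 a) - (\<Sum>i<Suc n. ((y - a) ^ Suc i / fact (Suc i)) *\<^sub>R g (Suc i) a)) {a..y}"
  proof (rule has_integral_diff[OF _ has_integral_taylor_sum[OF ay]])
    show "(g 1 has_integral (g 0 y - g 0 a)) {a..y}"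
      by (rule AC_on_has_integral_AE)
        (use ay sub AC_on_subset[OF Suc.prems(1)[of 0] sub] in \<open>auto intro: AE_mp[OF Suc.prems(2)[of 0]]\<close>)
  qed
  let ?S = "\<Sum>i<Suc n. ((y - a) ^ Suc i / fact (Suc i)) *\<^sub>R g (Suc i) a"
  have "norm ((g 0 y - g 0 a) - ?S) \<le> ((y - a) ^ n * integral {a..y} h) * measure lborel (cbox a y)"
    by (rule has_integral_bound[OF _ int[folded box_real(2)]])
      (use bound ay hy h(2) in \<open>auto intro!: mult_nonneg_nonneg integral_nonneg\<close>)
  also have "\<dots> = (y - a) ^ Suc n * integral {a..y} h"
    using ay by simp
  finally have "norm (g 0 y - g 0 a - ?S) \<le> (y - a) ^ Suc n * integral {a..y} h" .
  moreover have "(\<Sum>i\<le>Suc n. ((y - a) ^ i / fact i) *\<^sub>R g i a) = g 0 a + ?S"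
    by (subst sum.atMost_Suc_shift) (simp add: lessThan_Suc_atMost)
  ultimately show ?case by (simp only: diff_diff_eq)
qed

section \<open>Continuity of locally absolutely continuous functions\<close>

lemma AC_on_imp_continuous_on:
  fixes f :: "real \<Rightarrow> 'a::real_normed_vector"
  assumes "AC_on {a..b} f"
  shows "continuous_on {a..b} f"
  unfolding continuous_on_iff
proof (intro ballI allI impI)
  fix x e :: real assume x: "x \<in> {a..b}" and "e > 0"
  obtain d where "d > 0" and d: "\<forall>(S :: nat set) u v. finite S \<and> (\<forall>i\<in>S. u i \<le> v i \<and> {u i..v i} \<subseteq> {a..b}) \<and>
       (\<forall>i\<in>S. \<forall>j\<in>S. i \<noteq> j \<longrightarrow> {u i<..<v i} \<inter> {u j<..<v j} = {}) \<and>
       (\<Sum>i\<in>S. v i - u i) < d \<longrightarrow> (\<Sum>i\<in>S. norm (f (v i) - f (u i))) < e"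
    using AC_on_finite_family[OF assms \<open>e > 0\<close>] by (elim exE conjE)
  have *: "norm (f v - f u) < e" if "u \<le> v" "u \<in> {a..b}" "v \<in> {a..b}" "v - u < d" for u v
    using d[THEN spec, THEN spec, THEN spec, of "{0}" "\<lambda>_. u" "\<lambda>_. v"] that by simp
  show "\<exists>d>0. \<forall>x'\<in>{a..b}. dist x' x < d \<longrightarrow> dist (f x') (f x) < e"
  proof (intro exI[of _ d] conjI \<open>d > 0\<close> ballI impI)
    fix y assume y: "y \<in> {a..b}" "dist y x < d"
    show "dist (f y) (f x) < e"
    proof (cases "x \<le> y")
      case True
      then show ?thesis using *[of x y] x y by (simp add: dist_norm)
    next
      case False
      then show ?thesis using *[of y x] x y by (simp add: dist_norm norm_minus_commute)
    qed
  qed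
qed

lemma AC_loc_closed_imp_open:
  assumes "AC_loc_closed f"
  shows "AC_loc_open f"
  unfolding AC_loc_open_def
proof (intro allI impI)
  fix a b :: real assume "0 < a \<and> a \<le> b"
  then show "AC_on {a..b} f"
    using assms by (intro AC_on_subset[where I = "{0..b}" and J = "{a..b}"]) (auto simp: AC_loc_closed_def)
qed

lemma AC_loc_open_imp_continuous_on:
  fixes f :: "real \<Rightarrow> 'a::real_normed_vector"
  assumes "AC_loc_open f"
  shows "continuous_on {0<..} f"
proof -
  have "isCont f x" if "x > 0" for x
  proof (rule continuous_on_interior)
    show "continuous_on {x/2..x+1} f"
      using assms that by (intro AC_on_imp_continuous_on) (simp add: AC_loc_open_def)
  qed (use that in simp)
  then show ?thesis by (simp add: continuous_at_imp_continuous_on)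
qed

subsection \<open>Square integrability\<close>

lemma L2_on_bound:
  assumes "f \<in> borel_measurable (lebesgue_on S)" "L2_on S g"
    and "\<And>x. x \<in> S \<Longrightarrow> norm (f x) \<le> norm (g x)"
  shows "L2_on S f"
  unfolding L2_on_def
proof
  show "integrable (lebesgue_on S) (\<lambda>x. (norm (f x))\<^sup>2)"
  proof (rule Bochner_Integration.integrable_bound)
    show "integrable (lebesgue_on S) (\<lambda>x. (norm (g x))\<^sup>2)"
      using assms(2) by (simp add: L2_on_def)
    show "AE x in lebesgue_on S. norm ((norm (f x))\<^sup>2) \<le> norm ((norm (g x))\<^sup>2)"
      using assms(3) by (auto intro!: AE_I2 power_mono)
  qed (use assms(1) in measurable)
qed (rule assms(1))

lemma L2_on_cmult:
  assumes "L2_on S f"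
  shows "L2_on S (\<lambda>x. c * f x)"
  using assms by (auto simp: L2_on_def norm_mult power_mult_distrib)

lemma L2_on_add:
  assumes "L2_on S f" "L2_on S g"
  shows "L2_on S (\<lambda>x. f x + g x)"
  unfolding L2_on_def
proof
  have [measurable]: "f \<in> borel_measurable (lebesgue_on S)" "g \<in> borel_measurable (lebesgue_on S)"
    using assms by (auto simp: L2_on_def)
  show "(\<lambda>x. f x + g x) \<in> borel_measurable (lebesgue_on S)" by measurable
  show "integrable (lebesgue_on S) (\<lambda>x. (norm (f x + g x))\<^sup>2)"
  proof (rule Bochner_Integration.integrable_bound)
    show "integrable (lebesgue_on S) (\<lambda>x. 2 * (norm (f x))\<^sup>2 + 2 * (norm (g x))\<^sup>2)"
      using assms by (simp add: L2_on_def)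
    have "(norm (u + v))\<^sup>2 \<le> 2 * (norm u)\<^sup>2 + 2 * (norm v)\<^sup>2" for u v :: complex
    proof -
      have "(norm (u + v))\<^sup>2 \<le> (norm u + norm v)\<^sup>2"
        by (intro power_mono norm_triangle_ineq) simp
      also have "\<dots> \<le> 2 * (norm u)\<^sup>2 + 2 * (norm v)\<^sup>2"
        using zero_le_power2[of "norm u - norm v"] by (simp add: power2_sum power2_diff)
      finally show ?thesis .
    qed
    then show "AE x in lebesgue_on S. norm ((norm (f x + g x))\<^sup>2)
        \<le> norm (2 * (norm (f x))\<^sup>2 + 2 * (norm (g x))\<^sup>2)"
      by (auto intro!: AE_I2)
  qed measurable
qed

lemma L2_on_cong:
  assumes "\<And>x. x \<in> S \<Longrightarrow> f x = g x"
  shows "L2_on S f \<longleftrightarrow> L2_on S g"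
proof -
  have "f \<in> borel_measurable (lebesgue_on S) \<longleftrightarrow> g \<in> borel_measurable (lebesgue_on S)"
    by (rule measurable_cong) (simp add: assms)
  moreover have "integrable (lebesgue_on S) (\<lambda>x. (norm (f x))\<^sup>2) \<longleftrightarrow> integrable (lebesgue_on S) (\<lambda>x. (norm (g x))\<^sup>2)"
    by (rule Bochner_Integration.integrable_cong) (simp_all add: assms)
  ultimately show ?thesis by (simp add: L2_on_def)
qed

text \<open>For continuous functions the question moves from Lebesgue measure restricted to
  \<open>S\<close> to Borel measure on the line, where affine substitution and the nonnegative
  integral apply.\<close>

lemma L2_on_continuous_iff:
  assumes f: "continuous_on S f" and S: "S \<in> sets borel"
  shows "L2_on S f \<longleftrightarrow> integrable lborel (\<lambda>x. indicator S x * (norm (f x))\<^sup>2)"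
proof -
  have SL: "S \<in> sets lebesgue" using S by auto
  have "f \<in> borel_measurable (lebesgue_on S)"
    by (rule continuous_imp_measurable_on_sets_lebesgue[OF f SL])
  moreover have "(\<lambda>x. indicator S x *\<^sub>R (norm (f x))\<^sup>2) \<in> borel_measurable borel"
    by (rule borel_measurable_continuous_on_indicator) (use f S in \<open>auto intro!: continuous_intros\<close>)
  ultimately show ?thesis
    using SL by (simp add: L2_on_def integrable_restrict_space integrable_completion)
qed

text \<open>Affine substitution, together with the invariance of the half-line under multiplication
  by a positive \<open>c\<close>.\<close>

lemma L2_on_scale:
  assumes f: "continuous_on {0<..} f" "L2_on {0<..} f" and "c > 0"
  shows "L2_on {0<..} (\<lambda>x. f (c * x))"
proof -
  have "integrable lborel (\<lambda>x. indicator {0<..} x * (norm (f x))\<^sup>2)"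
    using f L2_on_continuous_iff[OF f(1)] by simp
  then have "integrable lborel (\<lambda>x. indicator {0<..} (0 + c * x) * (norm (f (0 + c * x)))\<^sup>2)"
    by (rule lborel_integrable_real_affine) (use \<open>c > 0\<close> in simp)
  moreover have "(indicator {0<..} (c * x) :: real) = indicator {0<..} x" for x
    using \<open>c > 0\<close> by (simp add: indicator_def zero_less_mult_iff)
  moreover have "continuous_on {0<..} (\<lambda>x. f (c * x))"
    by (rule continuous_on_compose2[OF f(1)]) (use \<open>c > 0\<close> in \<open>auto intro!: continuous_intros\<close>)
  ultimately show ?thesis by (simp add: L2_on_continuous_iff)
qed

text \<open>The top function of a chain is only Lebesgue measurable, while Tonelli's theorem will be
  applied to Borel functions. The norm, extended by 0 outside \<open>S\<close>, agrees almost
  everywhere with a Borel function, whose absolute value is taken.\<close>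

lemma L2_on_borel_majorant:
  assumes "L2_on S f" "S \<in> sets lebesgue"
  obtains h :: "real \<Rightarrow> real" where "h \<in> borel_measurable borel" "\<And>x. 0 \<le> h x"
    "integrable lborel (\<lambda>x. (h x)\<^sup>2)" "AE x in lebesgue. x \<in> S \<longrightarrow> norm (f x) \<le> h x"
proof -
  let ?q = "\<lambda>x. indicator S x * norm (f x)"
  have "(\<lambda>x. norm (f x)) \<in> borel_measurable (lebesgue_on S)"
    using assms by (auto simp: L2_on_def)
  then have q: "?q \<in> borel_measurable lebesgue"
    using assms(2) by (simp add: borel_measurable_restrict_space_iff)
  then obtain h where h[measurable]: "h \<in> borel_measurable borel" and eq: "AE x in lborel. ?q x = h x"
    using completion_ex_borel_measurable_real by (metis measurable_lborel2)
  have eqL: "AE x in lebesgue. ?q x = h x" using eq by (rule AE_completion)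
  have "integrable lebesgue (\<lambda>x. indicator S x *\<^sub>R (norm (f x))\<^sup>2)"
    using assms by (simp add: L2_on_def integrable_restrict_space)
  also have "?this \<longleftrightarrow> integrable lebesgue (\<lambda>x. (h x)\<^sup>2)"
  proof (rule integrable_cong_AE)
    show "AE x in lebesgue. indicator S x *\<^sub>R (norm (f x))\<^sup>2 = (h x)\<^sup>2"
      using eqL by eventually_elim (auto simp: indicator_def)
    have "(\<lambda>x. (?q x)\<^sup>2) \<in> borel_measurable lebesgue" using q by measurable
    then show "(\<lambda>x. indicator S x *\<^sub>R (norm (f x))\<^sup>2) \<in> borel_measurable lebesgue"
      by (rule back_subst[of "\<lambda>u. u \<in> borel_measurable lebesgue"]) (auto simp: indicator_def)
    show "(\<lambda>x. (h x)\<^sup>2) \<in> borel_measurable lebesgue" using h by (intro measurable_completion) simp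
  qed
  finally have "integrable lborel (\<lambda>x. (\<bar>h x\<bar>)\<^sup>2)"
    by (simp add: integrable_completion)
  moreover have "AE x in lebesgue. x \<in> S \<longrightarrow> norm (f x) \<le> \<bar>h x\<bar>"
    using eqL by eventually_elim auto
  ultimately show thesis by (intro that[of "\<lambda>x. \<bar>h x\<bar>"]) auto
qed

subsection \<open>Hardy's inequality\<close>

text \<open>The integrand is singular at 0, so the fundamental theorem is used in the form asking
  for a derivative only in the interior.\<close>

lemma has_integral_inverse_sqrt:
  assumes "0 \<le> x"
  shows "((\<lambda>t. 1 / sqrt t) has_integral 2 * sqrt x) {0..x}"
proof -
  have "((\<lambda>t. 1 / sqrt t) has_integral 2 * sqrt x - 2 * sqrt 0) {0..x}"
  proof (rule fundamental_theorem_of_calculus_interior[OF assms])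
    show "continuous_on {0..x} (\<lambda>t. 2 * sqrt t)" by (intro continuous_intros)
    show "((\<lambda>t. 2 * sqrt t) has_vector_derivative 1 / sqrt t) (at t)" if "t \<in> {0<..<x}" for t
      unfolding has_real_derivative_iff_has_vector_derivative[symmetric]
      using that by (auto intro!: derivative_eq_intros simp: field_simps)
  qed
  then show ?thesis by simp
qed

context
  fixes h :: "real \<Rightarrow> real" and H :: "real \<Rightarrow> real"
  assumes h[measurable]: "h \<in> borel_measurable borel" and h0: "\<And>x. 0 \<le> h x"
    and h2: "integrable lborel (\<lambda>x. (h x)\<^sup>2)"
  defines "H \<equiv> \<lambda>x. integral {0..x} h"
begin

text \<open>On a bounded interval the constant 1 is integrable, and \<open>(h x - 1)^2 >= 0\<close>
  gives \<open>h x <= 1 + (h x)^2\<close>. Hence the primitive from 0 is well defined.\<close>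

lemma square_integrable_imp_integrable_on: "h integrable_on {a..b}"
proof (rule measurable_bounded_by_integrable_imp_integrable_real)
  show "h \<in> borel_measurable (lebesgue_on {a..b})"
    by (intro measurable_restrict_space1 measurable_completion) simp
  have "(\<lambda>x. (h x)\<^sup>2) integrable_on {a..b}"
    using integrable_on_lborel[OF h2] by (rule integrable_on_subinterval) simp
  then show "(\<lambda>x. 1 + (h x)\<^sup>2) integrable_on {a..b}"
    by (intro integrable_add integrable_const_ivl)
  show "\<bar>h x\<bar> \<le> 1 + (h x)\<^sup>2" for x
    using zero_le_power2[of "h x - 1"] h0[of x] unfolding power2_diff by simp
qed simp

lemma primitive_nonneg: "0 \<le> H x"
  unfolding H_def by (rule integral_nonneg[OF square_integrable_imp_integrable_on]) (rule h0)

lemma primitive_mono: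
  assumes "x \<le> y"
  shows "H x \<le> H y"
  unfolding H_def
  by (rule integral_subset_le) (use assms h0 square_integrable_imp_integrable_on in auto)

lemma primitive_continuous: "continuous_on {0<..} H"
proof -
  have "isCont H x" if "x > 0" for x
  proof -
    have "continuous_on {0..x+1} H"
      unfolding H_def by (rule indefinite_integral_continuous_1[OF square_integrable_imp_integrable_on])
    then show ?thesis
      by (rule continuous_on_interior) (use that in simp)
  qed
  then show ?thesis by (simp add: continuous_at_imp_continuous_on)
qed

text \<open>Splitting \<open>h\<close> as \<open>(h * t powr (1/4)) * t powr (-1/4)\<close> makes Hardy's inequality a consequence of
  Tonelli's theorem, and the factor \<open>sqrt t\<close> yields the vanishing limits by dominated convergence.\<close>

lemma primitive_weighted_Cauchy_Schwarz:
  assumes "0 \<le> x"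
  shows "ennreal ((H x)\<^sup>2) \<le>
    ennreal (2 * sqrt x) * (\<integral>\<^sup>+t. ennreal ((h t)\<^sup>2 * sqrt t) * indicator {0..x} t \<partial>lborel)"
proof -
  \<comment> \<open>This is the weight \<open>t powr (1/4)\<close>: its square is
    \<open>sqrt t\<close>, and the square of its reciprocal is integrable near 0.\<close>
  define p where "p = (\<lambda>t. sqrt (sqrt t))"
  have [measurable]: "p \<in> borel_measurable borel" unfolding p_def by measurable
  let ?f = "\<lambda>t. ennreal (indicator {0..x} t * (h t * p t))"
  let ?g = "\<lambda>t. ennreal (indicator {0..x} t / p t)"
  have "ennreal (H x) = (\<integral>\<^sup>+t. ennreal (indicator {0..x} t * h t) \<partial>lborel)"
    unfolding H_def
    by (rule nn_integral_has_integral_lebesgue[symmetric])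
      (use h0 square_integrable_imp_integrable_on in \<open>auto intro: integrable_integral\<close>)
  also have "\<dots> = (\<integral>\<^sup>+t. ?f t * ?g t \<partial>lborel)"
  proof (rule nn_integral_cong_AE)
    \<comment> \<open>The factorization can fail at \<open>t = 0\<close>, where \<open>p\<close>
      vanishes and the product on the right is 0.\<close>
    show "AE t in lborel. ennreal (indicator {0..x} t * h t) = ?f t * ?g t"
      using AE_lborel_singleton[of 0]
      by eventually_elim (auto simp: indicator_def p_def h0 ennreal_mult[symmetric])
  qed
  finally have "ennreal ((H x)\<^sup>2) = (\<integral>\<^sup>+t. ?f t * ?g t \<partial>lborel)\<^sup>2"
    by (metis ennreal_power primitive_nonneg)
  also have "\<dots> \<le> (\<integral>\<^sup>+t. (?f t)\<^sup>2 \<partial>lborel) * (\<integral>\<^sup>+t. (?g t)\<^sup>2 \<partial>lborel)"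
    by (rule Cauchy_Schwarz_nn_integral) measurable
  also have "(\<integral>\<^sup>+t. (?f t)\<^sup>2 \<partial>lborel) = (\<integral>\<^sup>+t. ennreal ((h t)\<^sup>2 * sqrt t) * indicator {0..x} t \<partial>lborel)"
    by (rule nn_integral_cong) (auto simp: indicator_def p_def h0 ennreal_power power_mult_distrib)
  also have "(\<integral>\<^sup>+t. (?g t)\<^sup>2 \<partial>lborel) = (\<integral>\<^sup>+t. ennreal (indicator {0..x} t * (1 / sqrt t)) \<partial>lborel)"
    by (rule nn_integral_cong) (auto simp: indicator_def p_def ennreal_power power_divide)
  also have "\<dots> = ennreal (2 * sqrt x)"
    by (rule nn_integral_has_integral_lebesgue[OF _ has_integral_inverse_sqrt[OF assms]]) simp
  finally show ?thesis by (simp add: mult.commute)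
qed

text \<open>After the weighted Cauchy-Schwarz estimate the order of integration is exchanged. For
  fixed \<open>t\<close> the inner integral of \<open>2 * x powr (-3/2)\<close> over
  \<open>x >= t\<close> is \<open>4 / sqrt t\<close>, which cancels the weight \<open>sqrt t\<close>
  and leaves the constant 4.\<close>

lemma primitive_Hardy:
  "(\<integral>\<^sup>+x. ennreal ((H x / x)\<^sup>2) * indicator {0<..} x \<partial>lborel) \<le> (\<integral>\<^sup>+t. ennreal (4 * (h t)\<^sup>2) \<partial>lborel)"
proof -
  define w where "w = (\<lambda>x. 2 * sqrt x / x\<^sup>2)"
  define K where "K = (\<lambda>x t. ennreal (w x) * indicator {0<..} x * (ennreal ((h t)\<^sup>2 * sqrt t) * indicator {0..x} t))"
  have w[measurable]: "w \<in> borel_measurable borel" unfolding w_def by measurable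
  \<comment> \<open>Written as a condition on \<open>x\<close> and \<open>t\<close>, the indicator
    is visibly measurable in both variables jointly, as Tonelli's theorem requires.\<close>
  have ind: "(indicator {0..x} t :: ennreal) = (if 0 \<le> t \<and> t \<le> x then 1 else 0)" for x t :: real
    by (simp add: indicator_def)
  have K[measurable]: "case_prod K \<in> borel_measurable (lborel \<Otimes>\<^sub>M lborel)"
    unfolding K_def ind by measurable
  have "(\<integral>\<^sup>+x. ennreal ((H x / x)\<^sup>2) * indicator {0<..} x \<partial>lborel) \<le> (\<integral>\<^sup>+x. \<integral>\<^sup>+t. K x t \<partial>lborel \<partial>lborel)"
  proof (rule nn_integral_mono)
    fix x :: real
    show "ennreal ((H x / x)\<^sup>2) * indicator {0<..} x \<le> (\<integral>\<^sup>+t. K x t \<partial>lborel)"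
    proof (cases "x > 0")
      case True
      have "ennreal ((H x / x)\<^sup>2) = ennreal (1 / x\<^sup>2) * ennreal ((H x)\<^sup>2)"
        by (simp add: ennreal_mult[symmetric] power_divide)
      also have "\<dots> \<le> ennreal (1 / x\<^sup>2) * (ennreal (2 * sqrt x) *
          (\<integral>\<^sup>+t. ennreal ((h t)\<^sup>2 * sqrt t) * indicator {0..x} t \<partial>lborel))"
        using primitive_weighted_Cauchy_Schwarz[of x] True by (intro mult_left_mono) auto
      also have "\<dots> = ennreal (w x) * (\<integral>\<^sup>+t. ennreal ((h t)\<^sup>2 * sqrt t) * indicator {0..x} t \<partial>lborel)"
        using True by (simp add: mult.assoc[symmetric] ennreal_mult[symmetric] w_def)
      also have "\<dots> = (\<integral>\<^sup>+t. K x t \<partial>lborel)"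
        unfolding K_def using True by (subst nn_integral_cmult[symmetric]) simp_all
      finally show ?thesis using True by simp
    qed simp
  qed
  also have "\<dots> = (\<integral>\<^sup>+t. \<integral>\<^sup>+x. K x t \<partial>lborel \<partial>lborel)"
    by (rule lborel_pair.Fubini'[symmetric]) (rule K)
  also have "\<dots> \<le> (\<integral>\<^sup>+t. ennreal (4 * (h t)\<^sup>2) \<partial>lborel)"
  proof (rule nn_integral_mono)
    fix t :: real
    show "(\<integral>\<^sup>+x. K x t \<partial>lborel) \<le> ennreal (4 * (h t)\<^sup>2)"
    proof (cases "t > 0")
      case True
      have "(\<integral>\<^sup>+x. ennreal (w x) * indicator {t..} x \<partial>lborel) = ennreal (0 - (- 4 / sqrt t))"
      proof (rule nn_integral_FTC_atLeast[OF w])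
        fix x assume "t \<le> x"
        then have "x > 0" using True by simp
        then show "((\<lambda>x. - 4 / sqrt x) has_real_derivative w x) (at x)"
          unfolding w_def
          by (auto intro!: derivative_eq_intros simp: field_simps power2_eq_square real_sqrt_mult_self)
        show "0 \<le> w x" using \<open>x > 0\<close> by (simp add: w_def)
      next
        show "((\<lambda>x. - 4 / sqrt x) \<longlongrightarrow> 0) at_top"
          by (intro tendsto_divide_0[OF tendsto_const] filterlim_at_top_imp_at_infinity sqrt_at_top)
      qed
      moreover have "(\<integral>\<^sup>+x. K x t \<partial>lborel) =
          (\<integral>\<^sup>+x. ennreal ((h t)\<^sup>2 * sqrt t) * (ennreal (w x) * indicator {t..} x) \<partial>lborel)"
        by (rule nn_integral_cong) (use True in \<open>auto simp: K_def indicator_def mult_ac\<close>)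
      ultimately have "(\<integral>\<^sup>+x. K x t \<partial>lborel) = ennreal ((h t)\<^sup>2 * sqrt t) * ennreal (4 / sqrt t)"
        by (simp add: nn_integral_cmult)
      also have "\<dots> = ennreal (4 * (h t)\<^sup>2)"
        using True by (simp add: ennreal_mult[symmetric])
      finally show ?thesis by simp
    next
      case False
      \<comment> \<open>At \<open>t = 0\<close> the factor \<open>sqrt t\<close> vanishes; for
        negative \<open>t\<close> the indicator does.\<close>
      then have "K x t = 0" for x by (cases "t = 0") (auto simp: K_def)
      then show ?thesis by simp
    qed
  qed
  finally show ?thesis .
qed

lemma L2_on_Hardy_average: "L2_on {0<..} (\<lambda>x. complex_of_real (H x / x))"
proof -
  have cont: "continuous_on {0<..} (\<lambda>x. complex_of_real (H x / x))"
    by (intro continuous_intros primitive_continuous) auto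
  have m: "(\<lambda>x. indicator {0<..} x * (H x / x)\<^sup>2) \<in> borel_measurable lborel"
  proof -
    have "continuous_on {0<..} (\<lambda>x. (H x / x)\<^sup>2)"
      by (intro continuous_intros primitive_continuous) auto
    then show ?thesis
      using borel_measurable_continuous_on_indicator[of "{0<..}" "\<lambda>x. (H x / x)\<^sup>2"] by simp
  qed
  have "(\<integral>\<^sup>+x. ennreal (norm (indicator {0<..} x * (H x / x)\<^sup>2)) \<partial>lborel)
      = (\<integral>\<^sup>+x. ennreal ((H x / x)\<^sup>2) * indicator {0<..} x \<partial>lborel)"
    by (rule nn_integral_cong) (simp add: indicator_def)
  also have "\<dots> \<le> (\<integral>\<^sup>+t. ennreal (4 * (h t)\<^sup>2) \<partial>lborel)" by (rule primitive_Hardy)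
  also have "\<dots> < \<infinity>"
    using h2 by (subst nn_integral_eq_integral) auto
  finally have "integrable lborel (\<lambda>x. indicator {0<..} x * (H x / x)\<^sup>2)"
    using m by (simp add: integrable_iff_bounded)
  then show ?thesis
    by (subst L2_on_continuous_iff[OF cont]) (simp_all add: norm_divide power_divide)
qed

section \<open>Vanishing of \<open>(H x)^2 / x\<close> at infinity and at 0\<close>

text \<open>The weight is at most 1, so \<open>(h t)^2\<close> is an integrable majorant independent
  of \<open>x\<close>, as dominated convergence demands.\<close>

lemma square_weight_bound:
  assumes "x > 0"
  shows "norm ((h t)\<^sup>2 * (sqrt (t / x) * indicator {0..x} t)) \<le> (h t)\<^sup>2"
  using assms by (auto simp: indicator_def abs_mult intro!: mult_right_le_one_le)

text \<open>Dividing the weighted Cauchy-Schwarz estimate by \<open>x\<close> turns its weights into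
  \<open>2 * sqrt (t / x)\<close>. The resulting integrand tends to 0 for each \<open>t\<close> both
  as \<open>x\<close> grows and as \<open>x\<close> shrinks to 0.\<close>

lemma primitive_square_bound:
  assumes "x > 0"
  shows "(H x)\<^sup>2 / x \<le> 2 * (LINT t|lborel. (h t)\<^sup>2 * (sqrt (t / x) * indicator {0..x} t))"
proof -
  let ?k = "\<lambda>t. (h t)\<^sup>2 * (sqrt (t / x) * indicator {0..x} t)"
  have k0: "0 \<le> ?k t" for t using assms by (auto simp: indicator_def)
  have int: "integrable lborel ?k"
  proof (rule Bochner_Integration.integrable_bound[OF h2])
    show "AE t in lborel. norm (?k t) \<le> norm ((h t)\<^sup>2)"
      using square_weight_bound[OF assms] by simp
  qed measurable
  have "ennreal ((H x)\<^sup>2 / x) = ennreal (1 / x) * ennreal ((H x)\<^sup>2)"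
    using assms by (simp add: ennreal_mult[symmetric])
  also have "\<dots> \<le> ennreal (1 / x) * (ennreal (2 * sqrt x) *
      (\<integral>\<^sup>+t. ennreal ((h t)\<^sup>2 * sqrt t) * indicator {0..x} t \<partial>lborel))"
    using primitive_weighted_Cauchy_Schwarz[of x] assms by (intro mult_left_mono) auto
  also have "\<dots> = (\<integral>\<^sup>+t. ennreal (2 * sqrt x / x) * (ennreal ((h t)\<^sup>2 * sqrt t) * indicator {0..x} t) \<partial>lborel)"
    using assms by (subst nn_integral_cmult) (simp_all add: mult.assoc[symmetric] ennreal_mult[symmetric])
  also have "\<dots> = (\<integral>\<^sup>+t. ennreal (2 * ?k t) \<partial>lborel)"
  proof (rule nn_integral_cong)
    fix t :: real
    have "2 * sqrt x / x * ((h t)\<^sup>2 * sqrt t) = 2 * ((h t)\<^sup>2 * sqrt (t / x))"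
      using assms by (simp add: real_sqrt_divide field_simps)
    then show "ennreal (2 * sqrt x / x) * (ennreal ((h t)\<^sup>2 * sqrt t) * indicator {0..x} t) = ennreal (2 * ?k t)"
      using assms by (auto simp: indicator_def ennreal_mult[symmetric])
  qed
  also have "\<dots> = ennreal (LINT t|lborel. 2 * ?k t)"
    using int k0 by (intro nn_integral_eq_integral) auto
  finally show ?thesis
    using k0 by (subst (asm) ennreal_le_iff) (auto intro!: integral_nonneg_AE)
qed

lemma primitive_square_at_top: "((\<lambda>x. (H x)\<^sup>2 / x) \<longlongrightarrow> 0) at_top"
proof (rule tendsto_sandwich[OF _ _ tendsto_const])
  show "\<forall>\<^sub>F x in at_top. (H x)\<^sup>2 / x \<le> 2 * (LINT t|lborel. (h t)\<^sup>2 * (sqrt (t / x) * indicator {0..x} t))"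
    using eventually_gt_at_top[of 0] by eventually_elim (rule primitive_square_bound)
  show "\<forall>\<^sub>F x in at_top. 0 \<le> (H x)\<^sup>2 / x"
    using eventually_gt_at_top[of 0] by eventually_elim simp
  have "((\<lambda>x. LINT t|lborel. (h t)\<^sup>2 * (sqrt (t / x) * indicator {0..x} t)) \<longlongrightarrow> (LINT t|(lborel :: real measure). 0)) at_top"
  proof (rule integral_dominated_convergence_at_top[where w = "\<lambda>t. (h t)\<^sup>2"])
    show "AE t in lborel. ((\<lambda>x. (h t)\<^sup>2 * (sqrt (t / x) * indicator {0..x} t)) \<longlongrightarrow> 0) at_top"
    proof (intro AE_I2)
      fix t :: real
      have "((\<lambda>x. t / x) \<longlongrightarrow> 0) at_top"
        by (rule tendsto_divide_0[OF tendsto_const]) (rule filterlim_at_top_imp_at_infinity[OF filterlim_ident])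
      \<comment> \<open>The real \<open>sqrt\<close> is odd, so the absolute value covers negative
        \<open>t\<close> as well.\<close>
      then have "((\<lambda>x. \<bar>sqrt (t / x)\<bar>) \<longlongrightarrow> 0) at_top"
        using tendsto_rabs_zero tendsto_real_sqrt real_sqrt_zero by metis
      then have "((\<lambda>x. sqrt (t / x) * indicator {0..x} t) \<longlongrightarrow> 0) at_top"
        by (rule Lim_null_comparison[rotated]) (simp add: indicator_def)
      then show "((\<lambda>x. (h t)\<^sup>2 * (sqrt (t / x) * indicator {0..x} t)) \<longlongrightarrow> 0) at_top"
        by (rule tendsto_mult_right_zero)
    qed
    show "\<forall>\<^sub>F x in at_top. AE t in lborel. norm ((h t)\<^sup>2 * (sqrt (t / x) * indicator {0..x} t)) \<le> (h t)\<^sup>2"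
      using eventually_gt_at_top[of 0]
      by eventually_elim (intro AE_I2 square_weight_bound)
  qed (use h2 in measurable)
  then show "((\<lambda>x. 2 * (LINT t|lborel. (h t)\<^sup>2 * (sqrt (t / x) * indicator {0..x} t))) \<longlongrightarrow> 0) at_top"
    by (intro tendsto_mult_right_zero) simp
qed

text \<open>The substitution of \<open>inverse x\<close> for \<open>x\<close> moves the limit to
  infinity, where dominated convergence is stated.\<close>

lemma primitive_square_at_right_0: "((\<lambda>x. (H x)\<^sup>2 / x) \<longlongrightarrow> 0) (at_right 0)"
proof (rule tendsto_sandwich[OF _ _ tendsto_const])
  have pos: "\<forall>\<^sub>F x :: real in at_right 0. x > 0"
    by (simp add: eventually_at_right_less)
  have h2': "(\<lambda>t. (h t)\<^sup>2) integrable_on {0..1}"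
    using integrable_on_lborel[OF h2] by (rule integrable_on_subinterval) simp
  show "\<forall>\<^sub>F x in at_right 0. (H x)\<^sup>2 / x \<le> 2 * (LINT t|lborel. (h t)\<^sup>2 * (sqrt (t / x) * indicator {0..x} t))"
    using pos by eventually_elim (rule primitive_square_bound)
  show "\<forall>\<^sub>F x in at_right 0. 0 \<le> (H x)\<^sup>2 / x"
    using pos by eventually_elim simp
  have "((\<lambda>x. LINT t|lborel. (h t)\<^sup>2 * (sqrt (t / inverse x) * indicator {0..inverse x} t)) \<longlongrightarrow> (LINT t|(lborel :: real measure). 0)) at_top"
  proof (rule integral_dominated_convergence_at_top[where w = "\<lambda>t. (h t)\<^sup>2"])
    show "AE t in lborel. ((\<lambda>x. (h t)\<^sup>2 * (sqrt (t / inverse x) * indicator {0..inverse x} t)) \<longlongrightarrow> 0) at_top"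
    proof (intro AE_I2)
      fix t :: real
      \<comment> \<open>For \<open>t > 0\<close> the shrinking interval eventually excludes
        \<open>t\<close>; for \<open>t <= 0\<close> the weight is already 0.\<close>
      have "\<forall>\<^sub>F x in at_top. (h t)\<^sup>2 * (sqrt (t / inverse x) * indicator {0..inverse x} t) = 0"
        using eventually_gt_at_top[of 0] eventually_gt_at_top[of "inverse t"]
      proof eventually_elim
        case (elim x)
        then have "t > 0 \<Longrightarrow> inverse x < t" by (metis inverse_inverse_eq inverse_positive_iff_positive less_imp_inverse_less)
        then show ?case by (cases "t > 0") (auto simp: indicator_def)
      qed
      then show "((\<lambda>x. (h t)\<^sup>2 * (sqrt (t / inverse x) * indicator {0..inverse x} t)) \<longlongrightarrow> 0) at_top"
        by (rule tendsto_eventually)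
    qed
    show "\<forall>\<^sub>F x in at_top. AE t in lborel. norm ((h t)\<^sup>2 * (sqrt (t / inverse x) * indicator {0..inverse x} t)) \<le> (h t)\<^sup>2"
      using eventually_gt_at_top[of 0]
      by eventually_elim (intro AE_I2 square_weight_bound, simp)
  qed (use h2 in measurable)
  then show "((\<lambda>x. 2 * (LINT t|lborel. (h t)\<^sup>2 * (sqrt (t / x) * indicator {0..x} t))) \<longlongrightarrow> 0) (at_right 0)"
    unfolding filterlim_at_right_to_top by (intro tendsto_mult_right_zero) simp
qed

end

subsection \<open>Weighted square integrability of derivatives\<close>

text \<open>The leading coefficient is eliminated by passing from the family at \<open>t\<close> to the combination
  of its members at \<open>2 * t\<close> and \<open>t\<close> in which the top power cancels.\<close>

lemma polynomial_family_coefficients: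
  fixes a :: "nat \<Rightarrow> 'b \<Rightarrow> complex"
  assumes add: "\<And>f g. P f \<Longrightarrow> P g \<Longrightarrow> P (\<lambda>x. f x + g x)"
    and cmult: "\<And>c f. P f \<Longrightarrow> P (\<lambda>x. c * f x)"
    and "\<And>t. t > 0 \<Longrightarrow> P (\<lambda>x. \<Sum>i<n. of_real (t ^ i) * a i x)"
    and "i < n"
  shows "P (a i)"
  using assms(3,4)
proof (induction n arbitrary: a i)
  case (Suc n)
  have low: "P (a i)" if "i < n" for i
  proof -
    \<comment> \<open>Subtracting \<open>2 ^ n\<close> times the member at \<open>t\<close> from the
      member at \<open>2 * t\<close> multiplies coefficient \<open>i\<close> by
      \<open>2 ^ i - 2 ^ n\<close>, which is zero for \<open>i = n\<close> and nonzero for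
      \<open>i < n\<close>.\<close>
    have "P (\<lambda>x. of_real (2 ^ i - 2 ^ n) * a i x)"
    proof (rule Suc.IH[of "\<lambda>i x. of_real (2 ^ i - 2 ^ n) * a i x"])
      fix t :: real assume "t > 0"
      have "P (\<lambda>x. (\<Sum>i<Suc n. of_real ((2 * t) ^ i) * a i x) +
          (- (2 ^ n)) * (\<Sum>i<Suc n. of_real (t ^ i) * a i x))"
        using \<open>t > 0\<close> by (intro add cmult Suc.prems) auto
      also have "(\<lambda>x. (\<Sum>i<Suc n. of_real ((2 * t) ^ i) * a i x) +
          (- (2 ^ n)) * (\<Sum>i<Suc n. of_real (t ^ i) * a i x)) =
        (\<lambda>x. \<Sum>i<n. of_real (t ^ i) * (of_real (2 ^ i - 2 ^ n) * a i x))"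
        by (simp add: sum_distrib_left sum_subtractf sum_negf power_mult_distrib algebra_simps)
      finally show "P (\<lambda>x. \<Sum>i<n. of_real (t ^ i) * (of_real (2 ^ i - 2 ^ n) * a i x))" .
    qed (rule that)
    from cmult[OF this, of "inverse (of_real (2 ^ i - 2 ^ n))"]
    show ?thesis using that by (simp add: mult.assoc[symmetric] power_strict_increasing_iff flip: of_real_power)
  qed
  \<comment> \<open>At \<open>t = 1\<close> all powers are 1, so removing the lower coefficients one
    at a time from that member isolates \<open>a n\<close>.\<close>
  have "P (\<lambda>x. f x - (\<Sum>i<m. a i x))" if "P f" "m \<le> n" for f m
    using that
  proof (induction m)
    case (Suc m)
    have "P (\<lambda>x. (f x - (\<Sum>i<m. a i x)) + (- 1) * a m x)"
      using Suc low by (intro add cmult) auto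
    then show ?case by (simp add: algebra_simps)
  qed simp
  from this[OF Suc.prems(1)[of 1] order_refl] have "P (a n)" by simp
  with low Suc.prems(2) show ?case by (auto simp: less_Suc_eq)
qed simp

section \<open>Chains vanishing at 0: weighted bounds and limits\<close>

text \<open>Expand \<open>g k\<close> at 0 up to order \<open>n - 1 - k\<close>, so that the next
  derivative is \<open>g n\<close>. All Taylor coefficients vanish and only the remainder is
  left.\<close>

lemma H_chain_Taylor:
  assumes chain: "H_chain n f g" and k: "k < n"
    and h: "\<And>b. h integrable_on {0..b}" "\<And>x. 0 \<le> h x"
      "AE x in lebesgue. x \<in> {0<..} \<longrightarrow> norm (g n x) \<le> h x"
    and x: "x > 0"
  shows "norm (g k x) \<le> x ^ (n - 1 - k) * integral {0..x} h"
proof -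
  have n: "k + Suc (n - 1 - k) = n" using k by simp
  have "norm (g (k + 0) x - (\<Sum>i\<le>n - 1 - k. ((x - 0) ^ i / fact i) *\<^sub>R g (k + i) 0))
      \<le> (x - 0) ^ (n - 1 - k) * integral {0..x} h"
  proof (rule AC_taylor_bound[where g = "\<lambda>j. g (k + j)" and b = x])
    show "AE y in lebesgue. y \<in> {0..x} \<longrightarrow> norm (g (k + Suc (n - 1 - k)) y) \<le> h y"
      \<comment> \<open>The majorant is known only for positive arguments, so the left endpoint 0 is
        discarded as a null set.\<close>
      unfolding n using h(3) AE_completion[OF AE_lborel_singleton[of 0]] by eventually_elim auto
    show "AC_on {0..x} (g (k + j))" if "j \<le> n - 1 - k" for j
      using chain x k that by (auto simp: H_chain_def AC_loc_closed_def)
    show "AE y in lebesgue. y \<in> {0<..<x} \<longrightarrow>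
        (g (k + j) has_vector_derivative g (k + Suc j) y) (at y)" if "j \<le> n - 1 - k" for j
    proof -
      have "AE y in lebesgue. y > 0 \<longrightarrow> (g (k + j) has_vector_derivative g (Suc (k + j)) y) (at y)"
        using chain k that by (auto simp: H_chain_def deriv_chain_def)
      then show ?thesis by eventually_elim auto
    qed
  qed (use h x in auto)
  moreover have "(\<Sum>i\<le>n - 1 - k. ((x - 0) ^ i / fact i) *\<^sub>R g (k + i) 0) = 0"
    using chain k by (intro sum.neutral) (auto simp: H_chain_def)
  ultimately show ?thesis by simp
qed

lemma H_chain_conclusions:
  assumes chain: "H_chain n f g" and n: "n \<ge> 1"
  shows "j \<le> n \<Longrightarrow> L2_on {0<..} (\<lambda>x. g (n - j) x / complex_of_real (x ^ j))"
    and "j < n \<Longrightarrow> ((\<lambda>x. (norm (g j x))\<^sup>2 / x ^ (2*n - 2*j - 1)) \<longlongrightarrow> 0) at_top"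
    and "j < n \<Longrightarrow> ((\<lambda>x. (norm (g j x))\<^sup>2 / x ^ (2*n - 2*j - 1)) \<longlongrightarrow> 0) (at_right 0)"
proof -
  have L2: "L2_on {0<..} (g n)" using chain by (simp add: H_chain_def)
  obtain h :: "real \<Rightarrow> real" where h: "h \<in> borel_measurable borel" "\<And>x. 0 \<le> h x"
    "integrable lborel (\<lambda>x. (h x)\<^sup>2)" and le: "AE x in lebesgue. x \<in> {0<..} \<longrightarrow> norm (g n x) \<le> h x"
    by (rule L2_on_borel_majorant[OF L2]) auto
  define H where "H = (\<lambda>x. integral {0..x} h)"
  have avg: "L2_on {0<..} (\<lambda>x. complex_of_real (H x / x))"
    unfolding H_def by (rule L2_on_Hardy_average[OF h])
  have lim: "((\<lambda>x. (H x)\<^sup>2 / x) \<longlongrightarrow> 0) at_top" "((\<lambda>x. (H x)\<^sup>2 / x) \<longlongrightarrow> 0) (at_right 0)"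
    unfolding H_def by (rule primitive_square_at_top[OF h] primitive_square_at_right_0[OF h])+
  have Taylor: "norm (g k x) \<le> x ^ (n - 1 - k) * H x" if "k < n" "x > 0" for k x
    unfolding H_def using that
    by (intro H_chain_Taylor[OF chain _ square_integrable_imp_integrable_on[OF h] h(2) le])
  show "L2_on {0<..} (\<lambda>x. g (n - j) x / complex_of_real (x ^ j))" if "j \<le> n"
  proof (cases "j = 0")
    case True
    then show ?thesis using L2 by simp
  next
    case False
    \<comment> \<open>For \<open>g (n - j)\<close> the Taylor exponent is \<open>j - 1\<close>, one
      less than the power divided by, so exactly \<open>H x / x\<close> remains. The case
      \<open>j = 0\<close> has no remainder estimate and is the assumption on
      \<open>g n\<close>.\<close>
    have lt: "n - j < n" "n - 1 - (n - j) = j - 1" using False that by auto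
    have cont: "continuous_on {0<..} (g (n - j))"
      using chain lt(1) by (intro AC_loc_open_imp_continuous_on AC_loc_closed_imp_open) (simp add: H_chain_def)
    show ?thesis
    proof (rule L2_on_bound[OF _ avg])
      show "(\<lambda>x. g (n - j) x / complex_of_real (x ^ j)) \<in> borel_measurable (lebesgue_on {0<..})"
        by (intro continuous_imp_measurable_on_sets_lebesgue continuous_intros cont) auto
      fix x :: real assume "x \<in> {0<..}"
      then have x: "x > 0" by simp
      have "norm (g (n - j) x) / x ^ j \<le> x ^ (j - 1) * H x / x ^ j"
        using Taylor[OF lt(1) x] x unfolding lt(2) by (intro divide_right_mono) auto
      also have "\<dots> = H x / x" using x False by (cases j) simp_all
      also have "\<dots> \<le> norm (complex_of_real (H x / x))"
        unfolding norm_of_real by (rule abs_ge_self)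
      finally show "norm (g (n - j) x / complex_of_real (x ^ j)) \<le> norm (complex_of_real (H x / x))"
        using x by (simp add: norm_divide norm_power)
    qed
  qed
  have bound: "norm ((norm (g j x))\<^sup>2 / x ^ (2*n - 2*j - 1)) \<le> (H x)\<^sup>2 / x" if "j < n" "x > 0" for x
  proof -
    \<comment> \<open>The denominator is \<open>x ^ (2 * p + 1)\<close>, and squaring the Taylor
      bound gives \<open>x ^ (2 * p)\<close>, so one power of \<open>x\<close> survives below
      \<open>(H x)^2\<close>.\<close>
    define p where "p = n - 1 - j"
    have p: "2 * n - 2 * j - 1 = Suc (2 * p)" using that unfolding p_def by simp
    have "(norm (g j x))\<^sup>2 \<le> (x ^ p * H x)\<^sup>2"
      using Taylor[OF that] unfolding p_def by (intro power_mono) auto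
    then have "(norm (g j x))\<^sup>2 / x ^ Suc (2 * p) \<le> (x ^ p * H x)\<^sup>2 / x ^ Suc (2 * p)"
      using that by (intro divide_right_mono) auto
    also have "\<dots> = (H x)\<^sup>2 / x"
      using that by (simp add: power_mult_distrib power_even_eq)
    finally show ?thesis unfolding p using that by simp
  qed
  show "((\<lambda>x. (norm (g j x))\<^sup>2 / x ^ (2*n - 2*j - 1)) \<longlongrightarrow> 0) at_top" if "j < n"
  proof (rule Lim_null_comparison[OF _ lim(1)])
    show "\<forall>\<^sub>F x in at_top. norm ((norm (g j x))\<^sup>2 / x ^ (2*n - 2*j - 1)) \<le> (H x)\<^sup>2 / x"
      using eventually_gt_at_top[of 0] by eventually_elim (rule bound[OF that])
  qed
  show "((\<lambda>x. (norm (g j x))\<^sup>2 / x ^ (2*n - 2*j - 1)) \<longlongrightarrow> 0) (at_right 0)" if "j < n"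
  proof (rule Lim_null_comparison[OF _ lim(2)])
    show "\<forall>\<^sub>F x in at_right 0. norm ((norm (g j x))\<^sup>2 / x ^ (2*n - 2*j - 1)) \<le> (H x)\<^sup>2 / x"
      using eventually_at_right_less[of 0] by eventually_elim (rule bound[OF that])
  qed
qed

section \<open>Chains on the open half-line\<close>

text \<open>The bound \<open>n >= 2\<close> places index 1 among the Taylor coefficients
  \<open>i < n\<close>.\<close>

lemma Hhat_chain_derivative_weighted_L2:
  assumes chain: "Hhat_chain n f g" and n: "n \<ge> 2"
  shows "L2_on {0<..} (\<lambda>x. g 1 x / complex_of_real (x ^ (n - 1)))"
proof -
  have cont: "continuous_on {0<..} (g j)" if "j < n" for j
    using chain that by (intro AC_loc_open_imp_continuous_on) (simp add: Hhat_chain_def)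
  have L2: "L2_on {0<..} (g n)" using chain by (simp add: Hhat_chain_def)
  obtain h :: "real \<Rightarrow> real" where h: "h \<in> borel_measurable borel" "\<And>x. 0 \<le> h x"
    "integrable lborel (\<lambda>x. (h x)\<^sup>2)" and le: "AE x in lebesgue. x \<in> {0<..} \<longrightarrow> norm (g n x) \<le> h x"
    by (rule L2_on_borel_majorant[OF L2]) auto
  define H where "H = (\<lambda>x. integral {0..x} h)"
  have avg: "L2_on {0<..} (\<lambda>x. complex_of_real (H x / x))"
    unfolding H_def by (rule L2_on_Hardy_average[OF h])
  have avg_cont: "continuous_on {0<..} (\<lambda>x. complex_of_real (H x / x))"
    unfolding H_def by (intro continuous_intros primitive_continuous[OF h]) auto
  have quot_cont: "continuous_on {0<..} (\<lambda>x. g 0 x / complex_of_real (x ^ n))"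
    using n by (intro continuous_intros cont) auto
  have quot_L2: "L2_on {0<..} (\<lambda>x. g 0 x / complex_of_real (x ^ n))"
    using chain by (subst L2_on_cong[where g = "\<lambda>x. f x / complex_of_real (x ^ n)"]) (auto simp: Hhat_chain_def)
  \<comment> \<open>The expansion at \<open>x\<close> has increment \<open>t * x\<close>,
    proportional to \<open>x\<close>; this separates \<open>t ^ i\<close> from a coefficient
    depending on \<open>x\<close> alone.\<close>
  define a where "a = (\<lambda>i x. complex_of_real (x ^ i / (fact i * x ^ n)) * g i x)"
  have "L2_on {0<..} (a 1)"
  proof (rule polynomial_family_coefficients[where n = n and P = "L2_on {0<..}"])
    fix t :: real assume t: "t > 0"
    define c where "c = 1 + t"
    have c: "c > 0" using t by (simp add: c_def)
    \<comment> \<open>This is the Taylor remainder at \<open>(1 + t) * x\<close> divided by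
      \<open>x ^ n\<close>.\<close>
    define r where "r = (\<lambda>x. g 0 (c * x) / complex_of_real (x ^ n) - (\<Sum>i<n. of_real (t ^ i) * a i x))"
    have L1: "L2_on {0<..} (\<lambda>x. g 0 (c * x) / complex_of_real (x ^ n))"
    proof -
      have "L2_on {0<..} (\<lambda>x. of_real (c ^ n) * (g 0 (c * x) / complex_of_real ((c * x) ^ n)))"
        by (intro L2_on_cmult L2_on_scale[OF quot_cont quot_L2 c])
      then show ?thesis using c by (simp add: power_mult_distrib)
    qed
    have L2: "L2_on {0<..} r"
    proof (rule L2_on_bound)
      \<comment> \<open>The remainder bound \<open>(t * x) ^ (n - 1) * H (c * x) / x ^ n\<close>
        equals this constant times the Hardy average at \<open>c * x\<close>.\<close>
      show "L2_on {0<..} (\<lambda>x. of_real (t ^ (n - 1) * c) * complex_of_real (H (c * x) / (c * x)))"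
        by (intro L2_on_cmult L2_on_scale[OF avg_cont avg c])
      have "continuous_on {0<..} (\<lambda>x. g 0 (c * x))"
        using n c by (intro continuous_on_compose2[OF cont[of 0]]) (auto intro!: continuous_intros)
      then have "continuous_on {0<..} r"
        unfolding r_def a_def by (intro continuous_intros cont) auto
      then show "r \<in> borel_measurable (lebesgue_on {0<..})"
        by (intro continuous_imp_measurable_on_sets_lebesgue) auto
    next
      fix x :: real assume "x \<in> {0<..}"
      then have x: "x > 0" by simp
      have xc: "x \<le> c * x" using x t by (simp add: c_def algebra_simps)
      have sn: "Suc (n - 1) = n" and nl: "{..n - 1} = {..<n}" using n by auto
      have "norm (g 0 (c * x) - (\<Sum>i\<le>n - 1. ((c * x - x) ^ i / fact i) *\<^sub>R g i x))
          \<le> (c * x - x) ^ (n - 1) * integral {x..c * x} h"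
      proof (rule AC_taylor_bound[where b = "c * x"])
        show "AC_on {x..c * x} (g j)" if "j \<le> n - 1" for j
          using chain x xc that n by (auto simp: Hhat_chain_def AC_loc_open_def)
        show "AE y in lebesgue. y \<in> {x<..<c * x} \<longrightarrow> (g j has_vector_derivative g (Suc j) y) (at y)"
          if "j \<le> n - 1" for j
        proof -
          have "AE y in lebesgue. y > 0 \<longrightarrow> (g j has_vector_derivative g (Suc j) y) (at y)"
            using chain n that by (auto simp: Hhat_chain_def deriv_chain_def)
          then show ?thesis by eventually_elim (use x in auto)
        qed
        show "AE y in lebesgue. y \<in> {x..c * x} \<longrightarrow> norm (g (Suc (n - 1)) y) \<le> h y"
          unfolding sn using le by eventually_elim (use x in auto)
      qed (use h xc square_integrable_imp_integrable_on[OF h] in auto)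
      \<comment> \<open>The integral is extended down to 0, since Hardy's inequality concerns the
        primitive starting there.\<close>
      also have "\<dots> \<le> (c * x - x) ^ (n - 1) * H (c * x)"
        unfolding H_def using x xc h(2) square_integrable_imp_integrable_on[OF h]
        by (intro mult_left_mono integral_subset_le) auto
      finally have *: "norm (g 0 (c * x) - (\<Sum>i<n. ((t * x) ^ i / fact i) *\<^sub>R g i x))
          \<le> (t * x) ^ (n - 1) * H (c * x)"
        unfolding nl by (simp add: c_def algebra_simps)
      have "(\<Sum>i<n. of_real (t ^ i) * a i x) =
          (\<Sum>i<n. ((t * x) ^ i / fact i) *\<^sub>R g i x) / complex_of_real (x ^ n)"
        unfolding sum_divide_distrib
        by (rule sum.cong) (use x in \<open>auto simp: a_def scaleR_conv_of_real power_mult_distrib field_simps\<close>)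
      then have "r x = (g 0 (c * x) - (\<Sum>i<n. ((t * x) ^ i / fact i) *\<^sub>R g i x)) / complex_of_real (x ^ n)"
        by (simp add: r_def diff_divide_distrib)
      then have "norm (r x) \<le> (t * x) ^ (n - 1) * H (c * x) / x ^ n"
        using divide_right_mono[OF *, of "x ^ n"] x by (simp add: norm_divide norm_power)
      also have "\<dots> = t ^ (n - 1) * c * (H (c * x) / (c * x))"
        using x c n by (cases n) (simp_all add: power_mult_distrib)
      also have "\<dots> \<le> norm (of_real (t ^ (n - 1) * c) * complex_of_real (H (c * x) / (c * x)))"
        unfolding of_real_mult[symmetric] norm_of_real by (rule abs_ge_self)
      finally show "norm (r x) \<le> norm (of_real (t ^ (n - 1) * c) * complex_of_real (H (c * x) / (c * x)))" .
    qed
    have "L2_on {0<..} (\<lambda>x. g 0 (c * x) / complex_of_real (x ^ n) + (- 1) * r x)"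
      by (intro L2_on_add L2_on_cmult L1 L2)
    then show "L2_on {0<..} (\<lambda>x. \<Sum>i<n. of_real (t ^ i) * a i x)"
      by (simp add: r_def)
  qed (use n in \<open>auto intro: L2_on_add L2_on_cmult\<close>)
  then show ?thesis
  proof (rule L2_on_cong[THEN iffD1, rotated])
    fix x :: real assume "x \<in> {0<..}"
    then show "a 1 x = g 1 x / complex_of_real (x ^ (n - 1))"
      using n by (cases n) (simp_all add: a_def)
  qed
qed

theorem theorem3p2:
  shows
  "(\<forall>(n::nat) (f::real \<Rightarrow> complex) (g::nat \<Rightarrow> real \<Rightarrow> complex).
      n \<ge> 1 \<and> H_chain n f g \<longrightarrow>
        (\<forall>j\<le>n. L2_on {0<..} (\<lambda>x. g (n - j) x / complex_of_real (x ^ j))) \<and>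
        (\<forall>j<n. ((\<lambda>x. (norm (g j x))\<^sup>2 / x ^ (2*n - 2*j - 1)) \<longlongrightarrow> 0) at_top) \<and>
        (\<forall>j<n. ((\<lambda>x. (norm (g j x))\<^sup>2 / x ^ (2*n - 2*j - 1)) \<longlongrightarrow> 0) (at_right 0)))
   \<and>
   (\<forall>(n::nat) (f::real \<Rightarrow> complex) (g::nat \<Rightarrow> real \<Rightarrow> complex).
      n \<ge> 1 \<and> Hhat_chain n f g \<longrightarrow> in_Hhat (n - 1) (g 1))"
proof (intro conjI allI impI; elim conjE)
  fix n :: nat and f :: "real \<Rightarrow> complex" and g
  assume n: "1 \<le> n" and chain: "Hhat_chain n f g"
  have "L2_on {0<..} (\<lambda>x. g 1 x / complex_of_real (x ^ (n - 1)))"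
  \<comment> \<open>For \<open>n = 1\<close> the weight is \<open>x ^ 0\<close> and the claim is the
    assumption that \<open>g 1\<close> is square integrable.\<close>
  proof (cases "n = 1")
    case True
    then show ?thesis using chain by (simp add: Hhat_chain_def)
  next
    case False
    then show ?thesis using n by (intro Hhat_chain_derivative_weighted_L2[OF chain]) simp
  qed
  then have "Hhat_chain (n - 1) (g 1) (\<lambda>j. g (Suc j))"
    using chain n by (auto simp: Hhat_chain_def deriv_chain_def)
  then show "in_Hhat (n - 1) (g 1)" by (auto simp: in_Hhat_def)
qed (rule H_chain_conclusions; assumption)+

end
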